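(* There exists a numbering $\beta\colon A^\ast\to\mathbb{N}$ such that the formula $\exists y<x\; x=\overline{2}\times y$ binumerates in $\mathsf{R}$ the set $\{\beta(\phi)\mid \phi\text{ is an }\mathcal{L}\text{-sentence and }\mathbb{N}\models\phi\}$.
   Context: Language: $\mathcal{L}$ is the first-order arithmetical language with symbols $\mathsf{0},\mathsf{S},+,\times,=,\neg,\wedge,\forall$; $\mathbb{N}$ also denotes its standard interpretation. The finite alphabet $A$ consists of these symbols together with $\mathsf{v}$, $\prime$, $($ and $)$. $A^\ast$ is the set of nonempty finite strings over $A$. Variables are $\mathsf{v}$ followed by finitely many strokes; terms and formulae are the usual well-formed (fully parenthesised, infix) strings in $A^\ast$. Other logical symbols are the usual abbreviations; $x\le y$ abbreviates $\exists z\, z+x=y$ and $x<y$ abbreviates $x\le y\wedge x\ne y$. $\overline{n}$ is the standard numeral of $n$. A numbering of $A^\ast$ is an injective function $\beta\colon A^\ast\to\mathbb{N}$ (no computability required). The theory $\mathsf{R}$ has the axiom schemata (for all $m,n\in\mathbb{N}$): $\overline{m}+\overline{n}=\overline{m+n}$; $\overline{m}\times\overline{n}=\overline{m\cdot n}$; $\overline{m}\neq\overline{n}$ for $m\ne n$; $x\le\overline{n}\to\bigvee_{k\le n}x=\overline{k}$; $x\le\overline{n}\vee\overline{n}\le x$. A formula $\phi(x)$ binumerates $X\subseteq\mathbb{N}$ in $\mathsf{R}$ if $\mathsf{R}\vdash\phi(\overline{n})$ for $n\in X$ and $\mathsf{R}\vdash\neg\phi(\overline{n})$ for $n\notin X$.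 *)

theory Defs
  imports Main
begin

text \<open>
  Formulae are syntax trees over named variables; \<open>tm_string\<close> and \<open>fm_string\<close> spell them as
  strings over the alphabet. The lemma \<open>fm_string_inject\<close> (unique readability) lets us identify
  a formula with its spelling.
\<close>

datatype letter =
    LZero | LSucc | LPlus | LTimes | LEq | LNot | LAnd | LAll
  | LVar | LStroke | LOpen | LClose

type_synonym var = nat

datatype tm = Var var | Zero | Succ tm | Plus tm tm | Times tm tm

datatype fm = Eq tm tm | Neg fm | Conj fm fm | Forall var fm

definition strings :: "letter list set" where
  "strings = {w. w \<noteq> []}"

text \<open>The variable with index \<open>i\<close> is the letter \<open>v\<close> followed by \<open>i\<close> strokes.\<close>

definition var_string :: "var \<Rightarrow> letter list" where
  "var_string i = LVar # replicate i LStroke"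

primrec tm_string :: "tm \<Rightarrow> letter list" where
  "tm_string (Var i) = var_string i"
| "tm_string Zero = [LZero]"
| "tm_string (Succ t) = LSucc # tm_string t"
| "tm_string (Plus s t) = [LOpen] @ tm_string s @ [LPlus] @ tm_string t @ [LClose]"
| "tm_string (Times s t) = [LOpen] @ tm_string s @ [LTimes] @ tm_string t @ [LClose]"

primrec fm_string :: "fm \<Rightarrow> letter list" where
  "fm_string (Eq s t) = [LOpen] @ tm_string s @ [LEq] @ tm_string t @ [LClose]"
| "fm_string (Neg p) = LNot # fm_string p"
| "fm_string (Conj p q) = [LOpen] @ fm_string p @ [LAnd] @ fm_string q @ [LClose]"
| "fm_string (Forall i p) = [LAll] @ var_string i @ fm_string p"

lemma replicate_stroke_inject:
  assumes "replicate i LStroke @ u = replicate j LStroke @ w"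
    and "u = [] \<or> hd u \<noteq> LStroke" and "w = [] \<or> hd w \<noteq> LStroke"
  shows "i = j \<and> u = w"
  using assms
proof (induction i arbitrary: j)
  case 0
  then show ?case by (cases j) auto
next
  case (Suc i)
  then show ?case by (cases j) auto
qed

lemma tm_string_prefix_inject:
  assumes "tm_string s @ u = tm_string t @ w"
    and "u = [] \<or> hd u \<noteq> LStroke" and "w = [] \<or> hd w \<noteq> LStroke"
  shows "s = t \<and> u = w"
  using assms
proof (induction s arbitrary: t u w)
  case (Var i)
  then show ?case
    by (cases t) (auto simp: var_string_def dest: replicate_stroke_inject)
next
  case Zero
  then show ?case by (cases t) (auto simp: var_string_def)
next
  case (Succ s)
  show ?case
  proof (cases t)
    case t: (Succ r)
    from Succ.prems(1) t have "tm_string s @ u = tm_string r @ w" by simp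
    from Succ.IH[OF this Succ.prems(2,3)] t show ?thesis by simp
  qed (use Succ.prems(1) in \<open>simp_all add: var_string_def\<close>)
next
  case (Plus s1 s2)
  show ?case
  proof (cases t)
    case t: (Plus t1 t2)
    from Plus.prems(1) t have "tm_string s1 @ (LPlus # tm_string s2 @ LClose # u)
        = tm_string t1 @ (LPlus # tm_string t2 @ LClose # w)" by simp
    from Plus.IH(1)[OF this] have 1: "s1 = t1"
      and "tm_string s2 @ (LClose # u) = tm_string t2 @ (LClose # w)" by simp_all
    from Plus.IH(2)[OF this(2)] 1 t show ?thesis by simp
  next
    case t: (Times t1 t2)
    from Plus.prems(1) t have "tm_string s1 @ (LPlus # tm_string s2 @ LClose # u)
        = tm_string t1 @ (LTimes # tm_string t2 @ LClose # w)" by simp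
    from Plus.IH(1)[OF this] show ?thesis by simp
  qed (use Plus.prems(1) in \<open>simp_all add: var_string_def\<close>)
next
  case (Times s1 s2)
  show ?case
  proof (cases t)
    case t: (Times t1 t2)
    from Times.prems(1) t have "tm_string s1 @ (LTimes # tm_string s2 @ LClose # u)
        = tm_string t1 @ (LTimes # tm_string t2 @ LClose # w)" by simp
    from Times.IH(1)[OF this] have 1: "s1 = t1"
      and "tm_string s2 @ (LClose # u) = tm_string t2 @ (LClose # w)" by simp_all
    from Times.IH(2)[OF this(2)] 1 t show ?thesis by simp
  next
    case t: (Plus t1 t2)
    from Times.prems(1) t have "tm_string s1 @ (LTimes # tm_string s2 @ LClose # u)
        = tm_string t1 @ (LPlus # tm_string t2 @ LClose # w)" by simp
    from Times.IH(1)[OF this] show ?thesis by simp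
  qed (use Times.prems(1) in \<open>simp_all add: var_string_def\<close>)
qed

lemma tm_string_hd: "\<exists>c w. tm_string t = c # w \<and> c \<notin> {LStroke, LNot, LAll}"
  by (cases t) (auto simp: var_string_def)

lemma fm_string_hd: "\<exists>c w. fm_string p = c # w \<and> c \<in> {LOpen, LNot, LAll}"
  by (cases p) auto

text \<open>
  An opening parenthesis may start both a term and a formula, so the case of an equation against a
  conjunction rests on the fact that no term spelling and formula spelling have a common continuation.
\<close>

lemma tm_string_fm_string_clash:
  "tm_string s @ u = fm_string p @ w \<Longrightarrow> False"
proof (induction s arbitrary: p u w)
  case (Var i)
  then show ?case using fm_string_hd[of p] by (auto simp: var_string_def)
next
  case Zero
  then show ?case using fm_string_hd[of p] by auto
next
  case (Succ s)
  then show ?case using fm_string_hd[of p] by auto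
next
  case (Plus s1 s2)
  show ?case
  proof (cases p)
    case (Eq t1 t2)
    with Plus.prems have "tm_string s1 @ (LPlus # tm_string s2 @ LClose # u)
        = tm_string t1 @ (LEq # tm_string t2 @ LClose # w)" by simp
    from tm_string_prefix_inject[OF this] show ?thesis by simp
  next
    case (Conj q r)
    with Plus.prems show ?thesis using Plus.IH(1)[of _ q] by simp
  qed (use Plus.prems in auto)
next
  case (Times s1 s2)
  show ?case
  proof (cases p)
    case (Eq t1 t2)
    with Times.prems have "tm_string s1 @ (LTimes # tm_string s2 @ LClose # u)
        = tm_string t1 @ (LEq # tm_string t2 @ LClose # w)" by simp
    from tm_string_prefix_inject[OF this] show ?thesis by simp
  next
    case (Conj q r)
    with Times.prems show ?thesis using Times.IH(1)[of _ q] by simp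
  qed (use Times.prems in auto)
qed

lemma fm_string_prefix_inject:
  "fm_string p @ u = fm_string q @ w \<Longrightarrow> p = q \<and> u = w"
proof (induction p arbitrary: q u w)
  case (Eq s1 s2)
  show ?case
  proof (cases q)
    case q: (Eq t1 t2)
    from Eq.prems q have "tm_string s1 @ (LEq # tm_string s2 @ LClose # u)
        = tm_string t1 @ (LEq # tm_string t2 @ LClose # w)" by simp
    from tm_string_prefix_inject[OF this] have 1: "s1 = t1"
      and "tm_string s2 @ (LClose # u) = tm_string t2 @ (LClose # w)" by simp_all
    from tm_string_prefix_inject[OF this(2)] 1 q show ?thesis by simp
  next
    case (Conj q1 q2)
    with Eq.prems show ?thesis
      using tm_string_fm_string_clash[of s1 _ q1] by simp
  qed (use Eq.prems in auto)
next
  case (Neg p)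
  show ?case
  proof (cases q)
    case q: (Neg r)
    from Neg.prems q have "fm_string p @ u = fm_string r @ w" by simp
    from Neg.IH[OF this] q show ?thesis by simp
  qed (use Neg.prems in auto)
next
  case (Conj p1 p2)
  show ?case
  proof (cases q)
    case q: (Conj q1 q2)
    from Conj.prems q have "fm_string p1 @ (LAnd # fm_string p2 @ LClose # u)
        = fm_string q1 @ (LAnd # fm_string q2 @ LClose # w)" by simp
    from Conj.IH(1)[OF this] have 1: "p1 = q1"
      and "fm_string p2 @ (LClose # u) = fm_string q2 @ (LClose # w)" by simp_all
    from Conj.IH(2)[OF this(2)] 1 q show ?thesis by simp
  next
    case (Eq t1 t2)
    with Conj.prems show ?thesis
      using tm_string_fm_string_clash[of t1 _ p1] by (simp add: eq_commute)
  qed (use Conj.prems in auto)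
next
  case (Forall i p)
  show ?case
  proof (cases q)
    case q: (Forall j r)
    from Forall.prems q have "replicate i LStroke @ (fm_string p @ u)
        = replicate j LStroke @ (fm_string r @ w)" by (simp add: var_string_def)
    from replicate_stroke_inject[OF this] have "i = j" and "fm_string p @ u = fm_string r @ w"
      using fm_string_hd[of p] fm_string_hd[of r] by auto
    with Forall.IH q show ?thesis by simp
  qed (use Forall.prems in auto)
qed

lemma fm_string_inject: "fm_string p = fm_string q \<longleftrightarrow> p = q"
  using fm_string_prefix_inject[of p "[]" q "[]"] by auto

lemma fm_string_in_strings: "fm_string p \<in> strings"
  using fm_string_hd[of p] by (auto simp: strings_def)

primrec tm_vars :: "tm \<Rightarrow> var set" where
  "tm_vars (Var i) = {i}"
| "tm_vars Zero = {}"
| "tm_vars (Succ t) = tm_vars t"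
| "tm_vars (Plus s t) = tm_vars s \<union> tm_vars t"
| "tm_vars (Times s t) = tm_vars s \<union> tm_vars t"

primrec fm_free :: "fm \<Rightarrow> var set" where
  "fm_free (Eq s t) = tm_vars s \<union> tm_vars t"
| "fm_free (Neg p) = fm_free p"
| "fm_free (Conj p q) = fm_free p \<union> fm_free q"
| "fm_free (Forall i p) = fm_free p - {i}"

definition sentence :: "fm \<Rightarrow> bool" where
  "sentence p \<longleftrightarrow> fm_free p = {}"

primrec tm_val :: "(var \<Rightarrow> nat) \<Rightarrow> tm \<Rightarrow> nat" where
  "tm_val e (Var i) = e i"
| "tm_val e Zero = 0"
| "tm_val e (Succ t) = Suc (tm_val e t)"
| "tm_val e (Plus s t) = tm_val e s + tm_val e t"
| "tm_val e (Times s t) = tm_val e s * tm_val e t"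

primrec sat :: "(var \<Rightarrow> nat) \<Rightarrow> fm \<Rightarrow> bool" where
  "sat e (Eq s t) \<longleftrightarrow> tm_val e s = tm_val e t"
| "sat e (Neg p) \<longleftrightarrow> \<not> sat e p"
| "sat e (Conj p q) \<longleftrightarrow> sat e p \<and> sat e q"
| "sat e (Forall i p) \<longleftrightarrow> (\<forall>n. sat (e(i := n)) p)"

definition true_in_N :: "fm \<Rightarrow> bool" where
  "true_in_N p \<longleftrightarrow> (\<forall>e. sat e p)"

definition Disj :: "fm \<Rightarrow> fm \<Rightarrow> fm" where
  "Disj p q = Neg (Conj (Neg p) (Neg q))"

definition Imp :: "fm \<Rightarrow> fm \<Rightarrow> fm" where
  "Imp p q = Neg (Conj p (Neg q))"

definition Exists :: "var \<Rightarrow> fm \<Rightarrow> fm" where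
  "Exists i p = Neg (Forall i (Neg p))"

text \<open>The bound variable is the first one that occurs in neither term.\<close>

definition Le :: "tm \<Rightarrow> tm \<Rightarrow> fm" where
  "Le s t = (let z = (LEAST z. z \<notin> tm_vars s \<union> tm_vars t) in Exists z (Eq (Plus (Var z) s) t))"

definition Less :: "tm \<Rightarrow> tm \<Rightarrow> fm" where
  "Less s t = Conj (Le s t) (Neg (Eq s t))"

definition Exists_less :: "var \<Rightarrow> tm \<Rightarrow> fm \<Rightarrow> fm" where
  "Exists_less i t p = Exists i (Conj (Less (Var i) t) p)"

primrec numeral_tm :: "nat \<Rightarrow> tm" where
  "numeral_tm 0 = Zero"
| "numeral_tm (Suc n) = Succ (numeral_tm n)"

primrec tm_subst :: "var \<Rightarrow> tm \<Rightarrow> tm \<Rightarrow> tm" where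
  "tm_subst x r (Var i) = (if i = x then r else Var i)"
| "tm_subst x r Zero = Zero"
| "tm_subst x r (Succ t) = Succ (tm_subst x r t)"
| "tm_subst x r (Plus s t) = Plus (tm_subst x r s) (tm_subst x r t)"
| "tm_subst x r (Times s t) = Times (tm_subst x r s) (tm_subst x r t)"

text \<open>
  \<open>fm_subst x r p\<close> replaces the free occurrences of \<open>x\<close> in \<open>p\<close> by \<open>r\<close> without renaming bound
  variables; \<open>free_for r x p\<close> says that no variable of \<open>r\<close> gets captured.
\<close>

primrec fm_subst :: "var \<Rightarrow> tm \<Rightarrow> fm \<Rightarrow> fm" where
  "fm_subst x r (Eq s t) = Eq (tm_subst x r s) (tm_subst x r t)"
| "fm_subst x r (Neg p) = Neg (fm_subst x r p)"
| "fm_subst x r (Conj p q) = Conj (fm_subst x r p) (fm_subst x r q)"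
| "fm_subst x r (Forall i p) = (if i = x then Forall i p else Forall i (fm_subst x r p))"

primrec free_for :: "tm \<Rightarrow> var \<Rightarrow> fm \<Rightarrow> bool" where
  "free_for r x (Eq s t) \<longleftrightarrow> True"
| "free_for r x (Neg p) \<longleftrightarrow> free_for r x p"
| "free_for r x (Conj p q) \<longleftrightarrow> free_for r x p \<and> free_for r x q"
| "free_for r x (Forall i p) \<longleftrightarrow> x \<notin> fm_free (Forall i p) \<or> i \<notin> tm_vars r \<and> free_for r x p"

text \<open>
  Classical natural deduction with equality. The axioms in \<open>T\<close> are kept apart from the
  undischarged assumptions in \<open>G\<close>, so that the eigenvariable condition of \<open>AllI\<close> does not
  concern the axioms: an axiom with free variables stands for its universal closure.
\<close>

inductive deriv :: "fm set \<Rightarrow> fm set \<Rightarrow> fm \<Rightarrow> bool" for T :: "fm set" where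
  Axiom: "p \<in> T \<Longrightarrow> deriv T G p"
| Assm: "p \<in> G \<Longrightarrow> deriv T G p"
| NegI: "deriv T (insert p G) q \<Longrightarrow> deriv T (insert p G) (Neg q) \<Longrightarrow> deriv T G (Neg p)"
| Contr: "deriv T (insert (Neg p) G) q \<Longrightarrow> deriv T (insert (Neg p) G) (Neg q) \<Longrightarrow> deriv T G p"
| ConjI: "deriv T G p \<Longrightarrow> deriv T G q \<Longrightarrow> deriv T G (Conj p q)"
| ConjE1: "deriv T G (Conj p q) \<Longrightarrow> deriv T G p"
| ConjE2: "deriv T G (Conj p q) \<Longrightarrow> deriv T G q"
| AllI: "deriv T G p \<Longrightarrow> \<forall>q\<in>G. x \<notin> fm_free q \<Longrightarrow> deriv T G (Forall x p)"
| AllE: "deriv T G (Forall x p) \<Longrightarrow> free_for t x p \<Longrightarrow> deriv T G (fm_subst x t p)"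
| EqI: "deriv T G (Eq t t)"
| EqE: "deriv T G (Eq s t) \<Longrightarrow> deriv T G (fm_subst x s p) \<Longrightarrow>
    free_for s x p \<Longrightarrow> free_for t x p \<Longrightarrow> deriv T G (fm_subst x t p)"

definition provable :: "fm set \<Rightarrow> fm \<Rightarrow> bool" where
  "provable T p \<longleftrightarrow> deriv T {} p"

text \<open>\<open>Disj_upto n f\<close> is the disjunction of \<open>f 0\<close>, ..., \<open>f n\<close>.\<close>

primrec Disj_upto :: "nat \<Rightarrow> (nat \<Rightarrow> fm) \<Rightarrow> fm" where
  "Disj_upto 0 f = f 0"
| "Disj_upto (Suc n) f = Disj (Disj_upto n f) (f (Suc n))"

definition R_theory :: "fm set" where
  "R_theory =
     {Eq (Plus (numeral_tm m) (numeral_tm n)) (numeral_tm (m + n)) | m n. True}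
   \<union> {Eq (Times (numeral_tm m) (numeral_tm n)) (numeral_tm (m * n)) | m n. True}
   \<union> {Neg (Eq (numeral_tm m) (numeral_tm n)) | m n. m \<noteq> n}
   \<union> {Imp (Le (Var 0) (numeral_tm n)) (Disj_upto n (\<lambda>k. Eq (Var 0) (numeral_tm k))) | n. True}
   \<union> {Disj (Le (Var 0) (numeral_tm n)) (Le (numeral_tm n) (Var 0)) | n. True}"

text \<open>The formula \<open>p\<close>, read as \<open>p(x)\<close>, binumerates \<open>X\<close> in \<open>T\<close>.\<close>

definition binumerates :: "fm set \<Rightarrow> var \<Rightarrow> fm \<Rightarrow> nat set \<Rightarrow> bool" where
  "binumerates T x p X \<longleftrightarrow>
     (\<forall>n. (n \<in> X \<longrightarrow> provable T (fm_subst x (numeral_tm n) p)) \<and>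
          (n \<notin> X \<longrightarrow> provable T (Neg (fm_subst x (numeral_tm n) p))))"

text \<open>The value of a numbering at the empty string, which is not in \<open>strings\<close>, is irrelevant.\<close>

definition numbering :: "(letter list \<Rightarrow> nat) \<Rightarrow> bool" where
  "numbering \<beta> \<longleftrightarrow> inj_on \<beta> strings"

end

(* The formula defines the set of positive even numbers, in R as well as in the standard model
   (y < x excludes 0). As no computability is asked of a numbering, one may enumerate the
   infinitely many true sentences by the positive even numbers and send all other strings to odd
   numbers. *)

theory Submission
  imports Defs "HOL-Library.Countable_Set"
begin

section \<open>Substitution and the bound variable of \<open>Le\<close>\<close>

lemma tm_vars_numeral [simp]: "tm_vars (numeral_tm n) = {}"
  by (induction n) auto

lemma tm_subst_numeral [simp]: "tm_subst x r (numeral_tm n) = numeral_tm n"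
  by (induction n) auto

lemma fm_subst_Disj_upto:
  "fm_subst x r (Disj_upto n f) = Disj_upto n (\<lambda>k. fm_subst x r (f k))"
  by (induction n) (auto simp: Disj_def)

lemma free_for_Disj_upto: "(\<And>k. free_for r x (f k)) \<Longrightarrow> free_for r x (Disj_upto n f)"
  by (induction n) (auto simp: Disj_def)

lemma fm_free_Disj_upto: "fm_free (Disj_upto n f) = (\<Union>k\<le>n. fm_free (f k))"
  by (induction n) (auto simp: Disj_def atMost_Suc)

text \<open>The binder of \<open>Le\<close> depends on its arguments, so \<open>Le\<close> does not
  commute with substitution. Hence \<open>Le\<close> is unfolded to an explicit
  \<open>Exists\<close> before substituting.\<close>

lemma Le_eqI:
  assumes "z \<notin> tm_vars s \<union> tm_vars t" "\<And>y. y < z \<Longrightarrow> y \<in> tm_vars s \<union> tm_vars t"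
  shows "Le s t = Exists z (Eq (Plus (Var z) s) t)"
proof -
  have "(LEAST z. z \<notin> tm_vars s \<union> tm_vars t) = z"
    using assms by (intro Least_equality) (auto simp: not_less [symmetric])
  then show ?thesis by (simp add: Le_def)
qed

section \<open>Derivations in R\<close>

lemma deriv_ExistsI:
  assumes "deriv T (insert (Forall x (Neg p)) G) (fm_subst x t p)" and "free_for t x p"
  shows "deriv T G (Exists x p)"
  unfolding Exists_def
proof (rule NegI [OF assms(1)])
  have "deriv T (insert (Forall x (Neg p)) G) (fm_subst x t (Neg p))"
    by (rule AllE [OF Assm]) (use assms(2) in auto)
  then show "deriv T (insert (Forall x (Neg p)) G) (Neg (fm_subst x t p))"
    by simp
qed

lemma R_Plus: "deriv R_theory G (Eq (Plus (numeral_tm m) (numeral_tm n)) (numeral_tm (m + n)))"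
  by (rule Axiom) (auto simp: R_theory_def)

lemma R_Times: "deriv R_theory G (Eq (Times (numeral_tm m) (numeral_tm n)) (numeral_tm (m * n)))"
  by (rule Axiom) (auto simp: R_theory_def)

lemma R_neq: "m \<noteq> n \<Longrightarrow> deriv R_theory G (Neg (Eq (numeral_tm m) (numeral_tm n)))"
  by (rule Axiom) (auto simp: R_theory_def)

text \<open>The premise is required for all contexts above \<open>p\<close> because weakening is not a rule of
  \<open>deriv\<close>, and would clash with the eigenvariable condition.\<close>

lemma deriv_Neg_Disj_upto:
  assumes "\<And>G k. p \<in> G \<Longrightarrow> k \<le> n \<Longrightarrow> deriv T G (Neg (f k))" and "p \<in> G"
  shows "deriv T G (Neg (Disj_upto n f))"
  using assms
proof (induction n arbitrary: G)
  case 0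
  then show ?case by simp
next
  case (Suc n)
  let ?c = "Conj (Neg (Disj_upto n f)) (Neg (f (Suc n)))"
  \<comment> \<open>\<open>Disj\<close> is a negated conjunction, so the goal is
    \<open>Neg (Neg ?c)\<close>. The induction hypothesis, stated for all contexts, also covers the
    one with \<open>Neg ?c\<close> added.\<close>
  have "deriv T (insert (Neg ?c) G) ?c"
    using Suc.prems by (intro ConjI Suc.IH) auto
  then have "deriv T G (Neg (Neg ?c))"
    by (rule NegI) (simp add: Assm)
  then show ?case
    by (simp add: Disj_def)
qed

text \<open>The bound variable of the \<open>Le\<close> in the axiom is 1, so \<open>Var 1\<close> cannot be substituted into the
  axiom directly; the bound variable is first renamed to 2.\<close>

lemma R_le_numeral_cases:
  assumes G: "\<forall>q\<in>G. 0 \<notin> fm_free q \<and> 2 \<notin> fm_free q"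
  shows "deriv R_theory G (Imp (Exists 2 (Eq (Plus (Var 2) (Var 1)) (numeral_tm n)))
    (Disj_upto n (\<lambda>k. Eq (Var 1) (numeral_tm k))))"
proof -
  let ?E1 = "Exists 1 (Eq (Plus (Var 1) (Var 0)) (numeral_tm n))"
  let ?E2 = "Exists 2 (Eq (Plus (Var 2) (Var 0)) (numeral_tm n))"
  let ?D = "Disj_upto n (\<lambda>k. Eq (Var 0) (numeral_tm k))"
  let ?A1 = "Forall 1 (Neg (Eq (Plus (Var 1) (Var 0)) (numeral_tm n)))"
  let ?A2 = "Forall 2 (Neg (Eq (Plus (Var 2) (Var 0)) (numeral_tm n)))"
  let ?C = "Conj ?E2 (Neg ?D)"
  have Le: "Le (Var 0) (numeral_tm n) = ?E1"
    by (rule Le_eqI) auto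
  have "Imp (Le (Var 0) (numeral_tm n)) ?D \<in> R_theory"
    unfolding R_theory_def by blast
  then have "Imp ?E1 ?D \<in> R_theory"
    unfolding Le .
  then have ax: "deriv R_theory H (Neg (Conj ?E1 (Neg ?D)))" for H
    unfolding Imp_def by (rule Axiom)
  have "deriv R_theory G (Neg ?C)"
  proof (rule NegI)
    show "deriv R_theory (insert ?C G) (Conj ?E1 (Neg ?D))"
    proof (rule ConjI)
      show "deriv R_theory (insert ?C G) (Neg ?D)"
        by (rule ConjE2 [of _ _ ?E2]) (simp add: Assm)
      \<comment> \<open>\<open>?E1\<close> is \<open>Neg ?A1\<close>: instantiating
        \<open>?A1\<close> at \<open>Var 2\<close> and generalising gives \<open>?A2\<close>, which
        contradicts \<open>?E2\<close>.\<close>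
      let ?H = "insert ?A1 (insert ?C G)"
      have "deriv R_theory ?H (fm_subst 1 (Var 2) (Neg (Eq (Plus (Var 1) (Var 0)) (numeral_tm n))))"
        by (rule AllE [OF Assm]) auto
      then have "deriv R_theory ?H (Neg (Eq (Plus (Var 2) (Var 0)) (numeral_tm n)))"
        by simp
      then have A2: "deriv R_theory ?H ?A2"
        by (rule AllI) (use G in \<open>auto simp: Exists_def fm_free_Disj_upto\<close>)
      have "deriv R_theory ?H ?E2"
        by (rule ConjE1 [of _ _ _ "Neg ?D"]) (simp add: Assm)
      then have "deriv R_theory ?H (Neg ?A2)"
        by (simp only: Exists_def)
      with A2 have "deriv R_theory (insert ?C G) (Neg ?A1)"
        by (rule NegI)
      then show "deriv R_theory (insert ?C G) ?E1"
        by (simp only: Exists_def)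
    qed
  qed (rule ax)
  \<comment> \<open>With binder 2 in place of 1, \<open>Var 1\<close> can be substituted for
    \<open>Var 0\<close> without capture.\<close>
  then have "deriv R_theory G (Forall 0 (Neg ?C))"
    by (rule AllI) (use G in auto)
  then have "deriv R_theory G (fm_subst 0 (Var 1) (Neg ?C))"
    by (rule AllE) (auto simp: Exists_def intro: free_for_Disj_upto)
  then show ?thesis
    by (simp add: Exists_def Imp_def fm_subst_Disj_upto)
qed

section \<open>Proving and refuting the instances of the formula\<close>

abbreviation pos_even :: fm where
  "pos_even \<equiv> Exists_less 1 (Var 0) (Eq (Var 0) (Times (numeral_tm 2) (Var 1)))"

text \<open>The body of \<open>pos_even\<close> at the numeral of \<open>n\<close>, with
  \<open>t\<close> for the bound \<open>Var 1\<close>. The binder 2 comes from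
  \<open>Le (Var 1) (Var 0)\<close>; \<open>Le t (numeral_tm n)\<close> could choose another
  one.\<close>

abbreviation pos_even_matrix :: "tm \<Rightarrow> nat \<Rightarrow> fm" where
  "pos_even_matrix t n \<equiv>
     Conj (Conj (Exists 2 (Eq (Plus (Var 2) t) (numeral_tm n))) (Neg (Eq t (numeral_tm n))))
       (Eq (numeral_tm n) (Times (numeral_tm 2) t))"

lemma fm_subst_pos_even:
  "fm_subst 0 (numeral_tm n) pos_even = Exists 1 (pos_even_matrix (Var 1) n)"
proof -
  have "Le (Var 1) (Var 0) = Exists 2 (Eq (Plus (Var 2) (Var 1)) (Var 0))"
    by (rule Le_eqI) auto
  then show ?thesis
    by (simp add: Exists_less_def Less_def Exists_def)
qed

lemma provable_pos_even:
  assumes "k > 0"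
  shows "provable R_theory (fm_subst 0 (numeral_tm (2 * k)) pos_even)"
  unfolding provable_def fm_subst_pos_even
proof (rule deriv_ExistsI)
  \<comment> \<open>The outer witness is \<open>k\<close>; since k + k = 2k, it also witnesses k
    \<le> 2k.\<close>
  have Le: "deriv R_theory G (Exists 2 (Eq (Plus (Var 2) (numeral_tm k)) (numeral_tm (2 * k))))" for G
    using R_Plus [of _ k k] by (intro deriv_ExistsI [where t = "numeral_tm k"]) (auto simp: mult_2)
  have neq: "deriv R_theory G (Neg (Eq (numeral_tm k) (numeral_tm (2 * k))))" for G
    using assms by (intro R_neq) simp
  \<comment> \<open>Symmetry of equality: the left side of a reflexive equation is rewritten by the
    axiom.\<close>
  have eq: "deriv R_theory G (Eq (numeral_tm (2 * k)) (Times (numeral_tm 2) (numeral_tm k)))" for G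
    using EqE [OF R_Times [of G 2 k], of 0 "Eq (Var 0) (Times (numeral_tm 2) (numeral_tm k))"] EqI
    by simp
  have "deriv R_theory G (pos_even_matrix (numeral_tm k) (2 * k))" for G
    by (intro ConjI Le neq eq)
  then show "deriv R_theory {Forall 1 (Neg (pos_even_matrix (Var 1) (2 * k)))}
      (fm_subst 1 (numeral_tm k) (pos_even_matrix (Var 1) (2 * k)))"
    by (simp add: Exists_def)
qed (simp add: Exists_def)

text \<open>If y = k, the equation n = 2y becomes n = 2k, which R refutes when it is false. When it
  is true, the hypothesis on \<open>n\<close> forces k = n = 0, against the conjunct y \<noteq>
  n.\<close>

lemma pos_even_matrix_excludes_numeral:
  assumes n: "\<And>k. k > 0 \<Longrightarrow> n \<noteq> 2 * k" and G: "pos_even_matrix (Var 1) n \<in> G"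
  shows "deriv R_theory G (Neg (Eq (Var 1) (numeral_tm k)))"
proof -
  let ?H = "insert (Eq (Var 1) (numeral_tm k)) G"
  have v1: "deriv R_theory ?H (Eq (Var 1) (numeral_tm k))"
    by (rule Assm) simp
  have matrix: "deriv R_theory ?H (pos_even_matrix (Var 1) n)"
    using G by (intro Assm) simp
  show ?thesis
  proof (cases "n = 2 * k")
    case True
    with n [of k] have "k = n" by auto
    with v1 have "deriv R_theory ?H (Eq (Var 1) (numeral_tm n))" by simp
    then show ?thesis by (rule NegI) (rule ConjE2 [OF ConjE1 [OF matrix]])
  next
    case False
    have "deriv R_theory ?H (Eq (numeral_tm n) (Times (numeral_tm 2) (numeral_tm k)))"
      using EqE [OF v1, of 1 "Eq (numeral_tm n) (Times (numeral_tm 2) (Var 1))"] ConjE2 [OF matrix]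
      by simp
    then have "deriv R_theory ?H (Eq (numeral_tm n) (numeral_tm (2 * k)))"
      using EqE [OF R_Times [of ?H 2 k], of 0 "Eq (numeral_tm n) (Var 0)"] by simp
    then show ?thesis by (rule NegI) (rule R_neq [OF False])
  qed
qed

text \<open>A witness y would satisfy y \<le> n, so R confines it to the numerals 0, ..., n, and
  each of these is excluded.\<close>

lemma refutable_pos_even:
  assumes "\<And>k. k > 0 \<Longrightarrow> n \<noteq> 2 * k"
  shows "provable R_theory (Neg (fm_subst 0 (numeral_tm n) pos_even))"
proof -
  let ?Q = "pos_even_matrix (Var 1) n"
  let ?G = "{Neg (Forall 1 (Neg ?Q))}"
  let ?C = "Conj (Exists 2 (Eq (Plus (Var 2) (Var 1)) (numeral_tm n)))
    (Neg (Disj_upto n (\<lambda>k. Eq (Var 1) (numeral_tm k))))"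
  have "deriv R_theory ?G (Neg ?Q)"
  proof (rule NegI)
    have "deriv R_theory (insert ?Q ?G) ?Q"
      by (rule Assm) simp
    note le = ConjE1 [OF ConjE1 [OF this]]
    show "deriv R_theory (insert ?Q ?G) ?C"
    proof (rule ConjI [OF le])
      show "deriv R_theory (insert ?Q ?G) (Neg (Disj_upto n (\<lambda>k. Eq (Var 1) (numeral_tm k))))"
        using pos_even_matrix_excludes_numeral [OF assms]
        by (rule deriv_Neg_Disj_upto) auto
    qed
    \<comment> \<open>\<open>Neg ?C\<close> is the unfolded implication; the side condition holds as
      only \<open>Var 1\<close> is free in this context.\<close>
    show "deriv R_theory (insert ?Q ?G) (Neg ?C)"
      using R_le_numeral_cases [of "insert ?Q ?G" n] by (simp add: Imp_def Exists_def)
  qed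
  then have "deriv R_theory ?G (Forall 1 (Neg ?Q))"
    by (rule AllI) (auto simp: Exists_def)
  then have "deriv R_theory {} (Neg (Neg (Forall 1 (Neg ?Q))))"
    by (rule NegI) (simp add: Assm)
  then show ?thesis
    by (simp only: provable_def fm_subst_pos_even Exists_def)
qed

section \<open>Construction of the numbering\<close>

instance letter :: countable
  by countable_datatype

lemma infinite_true_sentences: "infinite {fm_string \<phi> | \<phi>. sentence \<phi> \<and> true_in_N \<phi>}"
proof -
  \<comment> \<open>Vacuous quantifications of 0 = 0 are true sentences, told apart by their bound
    variables.\<close>
  let ?f = "\<lambda>i. fm_string (Forall i (Eq Zero Zero))"
  have "infinite (range ?f)"
    by (rule range_inj_infinite) (auto intro!: injI simp only: fm_string_inject fm.inject)
  moreover have "range ?f \<subseteq> {fm_string \<phi> | \<phi>. sentence \<phi> \<and> true_in_N \<phi>}"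
  proof (rule image_subsetI)
    fix i
    have "sentence (Forall i (Eq Zero Zero)) \<and> true_in_N (Forall i (Eq Zero Zero))"
      by (simp add: sentence_def true_in_N_def)
    then show "?f i \<in> {fm_string \<phi> | \<phi>. sentence \<phi> \<and> true_in_N \<phi>}" by blast
  qed
  ultimately show ?thesis
    using infinite_super by blast
qed

lemma ex_inj_image_eq_pos_even:
  fixes A :: "'a::countable set"
  assumes "infinite A"
  shows "\<exists>\<beta> :: 'a \<Rightarrow> nat. inj \<beta> \<and> \<beta> ` A = {2 * k | k. k > 0}"
proof -
  \<comment> \<open>\<open>Suc\<close> in the even case skips 0. Parity separates the two cases, and
    A being infinite makes \<open>to_nat_on A\<close> surjective, so every positive even number is
    hit.\<close>
  define \<beta> where "\<beta> w = (if w \<in> A then 2 * Suc (to_nat_on A w) else Suc (2 * to_nat w))" for w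
  have bij: "bij_betw (to_nat_on A) A UNIV"
    using assms by (intro to_nat_on_infinite) auto
  have "inj \<beta>"
  proof (rule injI)
    fix u w
    assume eq: "\<beta> u = \<beta> w"
    have "even (\<beta> v) \<longleftrightarrow> v \<in> A" for v
      by (simp add: \<beta>_def)
    with eq have "u \<in> A \<longleftrightarrow> w \<in> A" by metis
    with eq show "u = w"
      using bij by (auto simp: \<beta>_def bij_betw_def dest: inj_onD split: if_splits)
  qed
  moreover have "\<beta> ` A = (\<lambda>k. 2 * Suc k) ` to_nat_on A ` A"
    unfolding image_image by (rule image_cong) (auto simp: \<beta>_def)
  then have "\<beta> ` A = (\<lambda>k. 2 * Suc k) ` UNIV"
    using bij by (simp add: bij_betw_def)
  then have "\<beta> ` A = {2 * k | k. k > 0}"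
    unfolding gr0_conv_Suc by blast
  ultimately show ?thesis by blast
qed

theorem mainTheorem3:
  "\<exists>\<beta> :: letter list \<Rightarrow> nat. numbering \<beta> \<and>
     binumerates R_theory 0
       (Exists_less 1 (Var 0) (Eq (Var 0) (Times (numeral_tm 2) (Var 1))))
       {\<beta> (fm_string \<phi>) | \<phi>. sentence \<phi> \<and> true_in_N \<phi>}"
proof -
  obtain \<beta> :: "letter list \<Rightarrow> nat" where "inj \<beta>"
    and \<beta>: "\<beta> ` {fm_string \<phi> | \<phi>. sentence \<phi> \<and> true_in_N \<phi>} = {2 * k | k. k > 0}"
    using ex_inj_image_eq_pos_even [OF infinite_true_sentences] by blast
  from \<open>inj \<beta>\<close> have "numbering \<beta>"
    by (auto simp: numbering_def intro: inj_on_subset)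
  moreover have "{\<beta> (fm_string \<phi>) | \<phi>. sentence \<phi> \<and> true_in_N \<phi>} = {2 * k | k. k > 0}"
    unfolding \<beta> [symmetric] by blast
  moreover have "binumerates R_theory 0 pos_even {2 * k | k. k > 0}"
    unfolding binumerates_def
  proof (intro allI conjI impI)
    fix n
    show "provable R_theory (fm_subst 0 (numeral_tm n) pos_even)" if "n \<in> {2 * k | k. k > 0}"
      using that provable_pos_even by auto
    show "provable R_theory (Neg (fm_subst 0 (numeral_tm n) pos_even))" if "n \<notin> {2 * k | k. k > 0}"
      using that by (intro refutable_pos_even) auto
  qed
  ultimately show ?thesis by (intro exI [of _ \<beta>]) simp
qed

end
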